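(* Assume: (1) $\nabla \mathbf{R}_H$ is Lipschitz continuous on $\mathbb{R}^d$ with constant $L_H$; (2) $\mathbf{R}_H$ is bounded below on $\mathbb{R}^d$; (3) there are constants $W_{ML}\ge 0$ and $W_{V,ML}\ge 0$ such that for all $x\in\mathbb{R}^d$ and all iterations $k$ $$\mathbb{E}\big[\|\nabla\mathbf{\hat R}_{ML}^{(k)}(x)\|_2^2\big]-\big\|\mathbb{E}[\nabla\mathbf{\hat R}_{ML}^{(k)}(x)]\big\|_2^2\le W_{ML}+W_{V,ML}\|\nabla\mathbf{R}_H(x)\|_2^2 .$$ Let $x_{k+1}=x_k-\alpha_k\nabla\mathbf{\hat R}_{ML}^{(k)}(x_k)$ for $k\ge1$, where the learning rates $\alpha_k\ge 0$ satisfy $$\sum_{k=1}^\infty\alpha_k=\infty,\qquad \sum_{k=1}^\infty\alpha_k^2<\infty,\qquad \alpha_k\le\frac{1}{L_H(W_{V,ML}+1)}\ \text{ for all }k .$$ Then $$\liminf_{k\to\infty}\ \mathbb{E}\big[\|\nabla\mathbf{R}_H(x_k)\|_2^2\big]=0 .$$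
   Context: Setting. $\xi$ is a random variable with sample space $\Xi$; $J_H(x,\xi)$ and $J_L(x,\xi)$ are a high-fidelity and a low-fidelity random objective, $x\in\mathbb{R}^d$. $\mathbf{R}$ is a risk metric (a statistic such as the expectation) mapping a random variable to a scalar, and $\mathbf{R}_H(x)=\mathbf{R}[J_H(x,\xi)]$, $\mathbf{R}_L(x)=\mathbf{R}[J_L(x,\xi)]$. $\mathbf{\hat R}_H^n(x)$, $\mathbf{\hat R}_L^n(x)$ denote sampling-based estimators of $\mathbf{R}_H(x)$, $\mathbf{R}_L(x)$ using $n$ i.i.d. samples of $\xi$; $\nabla$ denotes the gradient in $x$. The gradient estimators are unbiased: $\mathbb{E}[\nabla\mathbf{\hat R}_H^n(x)]=\nabla\mathbf{R}_H(x)$ and $\mathbb{E}[\nabla\mathbf{\hat R}_L^n(x)]=\nabla\mathbf{R}_L(x)$ for all $x$ and $n$. For sample sizes $M>N$, the multilevel Monte Carlo (MLMC) gradient estimator is $$\nabla\mathbf{\hat R}_{ML}^{(k)}(x)=\nabla\mathbf{\hat R}_H^N(x)-\big(\nabla\mathbf{\hat R}_L^N(x)-\nabla\mathbf{\hat R}_L^M(x)\big),$$ where $\nabla\mathbf{\hat R}_H^N$ and $\nabla\mathbf{\hat R}_L^N$ use the same $N$ samples and $\nabla\mathbf{\hat R}_L^M$ uses $M$ samples independent of these. The superscript $(k)$ indicates that at each iteration $k$ a new set of samples, independent of those of all earlier iterations, is used. $x_1$ is a given starting point. *)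

theory Defs
  imports "HOL-Probability.Probability"
begin

text \<open>The value is meaningful only where \<open>f\<close> is differentiable.\<close>

definition gradient :: "('a::real_inner \<Rightarrow> real) \<Rightarrow> 'a \<Rightarrow> 'a" where
  "gradient f x = (THE D. GDERIV f x :> D)"

text \<open>
  \<open>R\<close> is a functional on random variables, \<open>J\<close> a random objective and \<open>\<xi>\<close> the underlying
  random variable: \<open>risk R J \<xi> x\<close> is the risk of \<open>J x \<xi>\<close>.
\<close>

definition risk ::
  "(('w \<Rightarrow> real) \<Rightarrow> real) \<Rightarrow> ('a \<Rightarrow> 's \<Rightarrow> real) \<Rightarrow> ('w \<Rightarrow> 's) \<Rightarrow> 'a \<Rightarrow> real" where
  "risk R J \<xi> x = R (\<lambda>\<omega>. J x (\<xi> \<omega>))"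

text \<open>The joint law of \<open>n\<close> i.i.d. samples of \<open>\<xi>\<close>.\<close>

definition iid_law :: "'w measure \<Rightarrow> 's measure \<Rightarrow> ('w \<Rightarrow> 's) \<Rightarrow> nat \<Rightarrow> (nat \<Rightarrow> 's) measure" where
  "iid_law P S \<xi> n = (\<Pi>\<^sub>M i\<in>{..<n}. distr P S \<xi>)"

text \<open>
  An estimator family \<open>E\<close> takes the sample size \<open>n\<close>, the point \<open>x\<close> and a vector of \<open>n\<close> samples,
  encoded as an element of the product over \<open>{..<n}\<close>.
\<close>

type_synonym ('a, 's) estimator = "nat \<Rightarrow> 'a \<Rightarrow> (nat \<Rightarrow> 's) \<Rightarrow> real"

definition grad_est :: "('a::real_inner, 's) estimator \<Rightarrow> nat \<Rightarrow> 'a \<Rightarrow> (nat \<Rightarrow> 's) \<Rightarrow> 'a" where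
  "grad_est E n x z = gradient (\<lambda>y. E n y z) x"

text \<open>
  Standing assumptions on a gradient estimator of \<open>F\<close>.  Differentiability is only required
  almost surely at each point.  Joint measurability in the point and the samples makes the
  estimator a random variable also when evaluated at a random iterate.  The last clause is
  unbiasedness, including integrability.
\<close>

definition unbiased_grad_estimator ::
  "'w measure \<Rightarrow> 's measure \<Rightarrow> ('w \<Rightarrow> 's) \<Rightarrow> ('a::euclidean_space, 's) estimator \<Rightarrow>
    ('a \<Rightarrow> real) \<Rightarrow> bool" where
  "unbiased_grad_estimator P S \<xi> E F \<longleftrightarrow> (\<forall>n\<ge>1.
     (\<forall>x. AE z in iid_law P S \<xi> n. \<exists>D. GDERIV (\<lambda>y. E n y z) x :> D) \<and>
     (\<lambda>(x, z). grad_est E n x z) \<in> borel_measurable (borel \<Otimes>\<^sub>M (\<Pi>\<^sub>M i\<in>{..<n}. S)) \<and>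
     (\<forall>x. has_bochner_integral (iid_law P S \<xi> n) (grad_est E n x) (gradient F x)))"

text \<open>
  \<open>X k i\<close> is the \<open>i\<close>-th sample drawn at iteration \<open>k\<close>; \<open>batch X k m n\<close> is the vector of the \<open>n\<close>
  samples \<open>X k m, \<dots>, X k (m + n - 1)\<close>.
\<close>

definition batch :: "(nat \<Rightarrow> nat \<Rightarrow> 'w \<Rightarrow> 's) \<Rightarrow> nat \<Rightarrow> nat \<Rightarrow> nat \<Rightarrow> 'w \<Rightarrow> (nat \<Rightarrow> 's)" where
  "batch X k m n \<omega> = (\<lambda>i\<in>{..<n}. X k (m + i) \<omega>)"

text \<open>
  The two size-\<open>N\<close> terms share the first \<open>N\<close> samples of iteration \<open>k\<close>; the size-\<open>M\<close> term uses the
  following \<open>M\<close> samples.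
\<close>

definition mlmc_grad ::
  "('a::real_inner, 's) estimator \<Rightarrow> ('a, 's) estimator \<Rightarrow> nat \<Rightarrow> nat \<Rightarrow>
    (nat \<Rightarrow> nat \<Rightarrow> 'w \<Rightarrow> 's) \<Rightarrow> nat \<Rightarrow> 'a \<Rightarrow> 'w \<Rightarrow> 'a" where
  "mlmc_grad EH EL N M X k x \<omega> =
     grad_est EH N x (batch X k 0 N \<omega>)
     - (grad_est EL N x (batch X k 0 N \<omega>) - grad_est EL M x (batch X k N M \<omega>))"

end

theory Submission
  imports Defs
begin

text \<open>
  At a deterministic point \<open>y\<close> the descent lemma, unbiasedness and the variance bound give
  \<open>E f (y - \<alpha> G) + \<alpha>/2 * |\<nabla>f y|\<^sup>2 \<le> f y + L \<alpha>\<^sup>2 W/2\<close> for \<open>f = R\<^sub>H - inf R\<^sub>H\<close>.  The iterate \<open>x\<^sub>k\<close> is a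
  measurable function of the samples of the iterations before \<open>k\<close>, hence independent of those of
  iteration \<open>k\<close>, so by Tonelli the inequality may be averaged over \<open>y = x\<^sub>k\<close>.  Summing over \<open>k\<close>
  bounds \<open>\<Sum> \<alpha>\<^sub>k E |\<nabla>f x\<^sub>k|\<^sup>2\<close>, which forces the limit inferior to vanish because \<open>\<Sum> \<alpha>\<^sub>k\<close> diverges.
  Since \<open>f\<close> is nonnegative, everything is done with nonnegative extended integrals and no
  integrability along the iterates has to be established.
\<close>

section \<open>Gradients and the expected decrease of one step\<close>

lemma gradient_eq:
  assumes "GDERIV f y :> D"
  shows "gradient f y = D"
  unfolding gradient_def
proof (rule the_equality)
  fix D' assume "GDERIV f y :> D'"
  then have "(\<lambda>h. inner h D') = (\<lambda>h. inner h D)"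
    using assms unfolding gderiv_def by (rule has_derivative_unique)
  then have "inner (D' - D) (D' - D) = 0"
    by (simp add: inner_diff_right fun_eq_iff)
  then show "D' = D"
    by simp
qed (fact assms)

text \<open>The descent lemma. Along the segment from \<open>y\<close> to \<open>y + v\<close>, the
  gap between \<open>f\<close> and its quadratic model has nonpositive derivative, by Cauchy-Schwarz
  and the Lipschitz bound on \<open>F\<close>; the claim compares the endpoints of the
  segment.\<close>

lemma lipschitz_gradient_upper_bound:
  fixes f :: "'a::real_inner \<Rightarrow> real"
  assumes der: "\<And>y. GDERIV f y :> F y" and lip: "L-lipschitz_on UNIV F"
  shows "f (y + v) \<le> f y + inner v (F y) + L / 2 * (norm v)\<^sup>2"
proof -
  define \<phi> where "\<phi> t = f (y + t *\<^sub>R v) - t * inner v (F y) - L / 2 * t\<^sup>2 * (norm v)\<^sup>2" for t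
  have "\<phi> 1 \<le> \<phi> 0"
  proof (rule DERIV_nonpos_imp_nonincreasing[of 0 1])
    fix t :: real
    assume t: "0 \<le> t" "t \<le> 1"
    define D where "D = inner v (F (y + t *\<^sub>R v)) - inner v (F y) - L * t * (norm v)\<^sup>2"
    have "((\<lambda>t. y + t *\<^sub>R v) has_derivative (\<lambda>h. h *\<^sub>R v)) (at t)"
      by (auto intro!: derivative_eq_intros)
    from has_derivative_compose[OF this der[unfolded gderiv_def]]
    have "((\<lambda>t. f (y + t *\<^sub>R v)) has_real_derivative inner v (F (y + t *\<^sub>R v))) (at t)"
      by (simp add: has_field_derivative_def mult_commute_abs)
    then have "(\<phi> has_real_derivative D) (at t)"
      unfolding \<phi>_def D_def by (auto intro!: derivative_eq_intros)
    moreover have "D \<le> 0"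
    proof -
      have "inner v (F (y + t *\<^sub>R v) - F y) \<le> norm v * norm (F (y + t *\<^sub>R v) - F y)"
        by (rule norm_cauchy_schwarz)
      also have "norm (F (y + t *\<^sub>R v) - F y) \<le> L * norm (t *\<^sub>R v)"
        using lipschitz_onD[OF lip, of "y + t *\<^sub>R v" y] by (simp add: dist_norm)
      finally have "inner v (F (y + t *\<^sub>R v) - F y) \<le> norm v * (L * (t * norm v))"
        using t by (simp add: mult_left_mono)
      then show ?thesis
        unfolding D_def by (simp add: inner_diff_right power2_eq_square algebra_simps)
    qed
    ultimately show "\<exists>D. (\<phi> has_real_derivative D) (at t) \<and> D \<le> 0"
      by blast
  qed simp
  then show ?thesis
    by (simp add: \<phi>_def)
qed

text \<open>Integrating the descent lemma with \<open>v = - a *\<^sub>R g \<omega>\<close>, the mean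
  \<open>F y\<close> of \<open>g\<close> turns the linear term into a decrease by \<open>a\<close>
  times the squared gradient norm, and the small step size keeps the quadratic term from consuming
  more than half of it, up to the noise \<open>W\<close>.\<close>

lemma (in prob_space) expected_gradient_step_decrease:
  fixes f :: "'b::euclidean_space \<Rightarrow> real" and g :: "'a \<Rightarrow> 'b"
  assumes nonneg: "\<And>y. 0 \<le> f y"
    and der: "\<And>y. GDERIV f y :> F y" and lip: "L-lipschitz_on UNIV F"
    and g: "has_bochner_integral M g (F y)" and g2: "integrable M (\<lambda>\<omega>. (norm (g \<omega>))\<^sup>2)"
    and var: "(\<integral>\<omega>. (norm (g \<omega>))\<^sup>2 \<partial>M) - (norm (F y))\<^sup>2 \<le> W + V * (norm (F y))\<^sup>2"
    and a: "0 \<le> a" "a * (L * (V + 1)) \<le> 1" and W: "0 \<le> W"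
  shows "(\<integral>\<^sup>+\<omega>. ennreal (f (y - a *\<^sub>R g \<omega>)) \<partial>M) + ennreal (a / 2 * (norm (F y))\<^sup>2)
    \<le> ennreal (f y) + ennreal (L / 2 * W * a\<^sup>2)"
proof -
  have L: "0 \<le> L"
    using lip by (rule lipschitz_on_nonneg)
  \<comment> \<open>The upper bound from the descent lemma. It is affine in
    \<open>g \<omega>\<close> and its squared norm, hence integrable, and nonnegative because it
    dominates \<open>f\<close>. Its real integral can therefore be computed first and transferred to
    the extended integral of \<open>f\<close>.\<close>
  define u where "u \<omega> = f y - a * inner (g \<omega>) (F y) + L / 2 * a\<^sup>2 * (norm (g \<omega>))\<^sup>2" for \<omega>
  have le: "f (y - a *\<^sub>R g \<omega>) \<le> u \<omega>" for \<omega>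
    using lipschitz_gradient_upper_bound[OF der lip, of y "- a *\<^sub>R g \<omega>"]
    by (simp add: u_def power_mult_distrib mult.assoc)
  have u0: "0 \<le> u \<omega>" for \<omega>
    using nonneg le order_trans by blast
  have int_g: "integrable M g" and exp_g: "(\<integral>\<omega>. g \<omega> \<partial>M) = F y"
    using g by (auto simp: has_bochner_integral_iff)
  have int_u: "integrable M u"
    unfolding u_def using int_g g2 by auto
  have "(\<integral>\<omega>. u \<omega> \<partial>M)
      = f y - a * (norm (F y))\<^sup>2 + L / 2 * a\<^sup>2 * (\<integral>\<omega>. (norm (g \<omega>))\<^sup>2 \<partial>M)"
    unfolding u_def using int_g g2 exp_g
    by (simp add: prob_space power2_norm_eq_inner)
  \<comment> \<open>Moving the squared mean to the right of the variance bound turns the factor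
    \<open>V\<close> into \<open>V + 1\<close>.\<close>
  also have "\<dots> \<le> f y - a * (norm (F y))\<^sup>2 + L / 2 * a\<^sup>2 * (W + (V + 1) * (norm (F y))\<^sup>2)"
    using var L by (intro add_left_mono mult_left_mono) (auto simp: algebra_simps)
  also have "\<dots> = f y - a * (norm (F y))\<^sup>2 + L / 2 * W * a\<^sup>2
      + a / 2 * (a * (L * (V + 1))) * (norm (F y))\<^sup>2"
    by (simp add: algebra_simps power2_eq_square)
  \<comment> \<open>The rate condition replaces \<open>a * (L * (V + 1))\<close> by 1, so half of
    the linear decrease survives.\<close>
  also have "\<dots> \<le> f y - a * (norm (F y))\<^sup>2 + L / 2 * W * a\<^sup>2 + a / 2 * 1 * (norm (F y))\<^sup>2"
    using a by (intro add_left_mono mult_right_mono mult_left_mono) auto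
  finally have bound: "(\<integral>\<omega>. u \<omega> \<partial>M) + a / 2 * (norm (F y))\<^sup>2 \<le> f y + L / 2 * W * a\<^sup>2"
    by simp
  have "(\<integral>\<^sup>+\<omega>. ennreal (f (y - a *\<^sub>R g \<omega>)) \<partial>M) \<le> (\<integral>\<^sup>+\<omega>. ennreal (u \<omega>) \<partial>M)"
    using le by (intro nn_integral_mono ennreal_leI)
  also have "\<dots> = ennreal (\<integral>\<omega>. u \<omega> \<partial>M)"
    using int_u u0 by (intro nn_integral_eq_integral) auto
  finally have "(\<integral>\<^sup>+\<omega>. ennreal (f (y - a *\<^sub>R g \<omega>)) \<partial>M) + ennreal (a / 2 * (norm (F y))\<^sup>2)
      \<le> ennreal (\<integral>\<omega>. u \<omega> \<partial>M) + ennreal (a / 2 * (norm (F y))\<^sup>2)"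
    by (rule add_right_mono)
  also have "\<dots> = ennreal ((\<integral>\<omega>. u \<omega> \<partial>M) + a / 2 * (norm (F y))\<^sup>2)"
    using u0 a by (subst ennreal_plus) auto
  also have "\<dots> \<le> ennreal (f y + L / 2 * W * a\<^sup>2)"
    using bound by (rule ennreal_leI)
  also have "\<dots> = ennreal (f y) + ennreal (L / 2 * W * a\<^sup>2)"
    using nonneg L W by (intro ennreal_plus) auto
  finally show ?thesis .
qed

section \<open>Decoupling by independence and a liminf criterion\<close>

text \<open>The joint law of independent variables is a product measure, so Tonelli applies. This
  takes the place of conditioning on the past: the first argument is frozen while the second is
  averaged.\<close>

lemma (in prob_space) nn_integral_indep_var:
  assumes ind: "indep_var A a B b"
    and F: "(\<lambda>(u, v). F u v) \<in> borel_measurable (A \<Otimes>\<^sub>M B)"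
  shows "(\<integral>\<^sup>+\<omega>. F (a \<omega>) (b \<omega>) \<partial>M) = (\<integral>\<^sup>+\<omega>. \<integral>\<^sup>+\<omega>'. F (a \<omega>) (b \<omega>') \<partial>M \<partial>M)"
proof -
  note [measurable] = indep_var_rv1[OF ind] indep_var_rv2[OF ind] F
  interpret B: prob_space "distr M B b"
    by (rule prob_space_distr) simp
  have "(\<integral>\<^sup>+\<omega>. F (a \<omega>) (b \<omega>) \<partial>M)
      = (\<integral>\<^sup>+p. (case p of (u, v) \<Rightarrow> F u v) \<partial>distr M (A \<Otimes>\<^sub>M B) (\<lambda>\<omega>. (a \<omega>, b \<omega>)))"
    by (subst nn_integral_distr) auto
  also have "distr M (A \<Otimes>\<^sub>M B) (\<lambda>\<omega>. (a \<omega>, b \<omega>)) = distr M A a \<Otimes>\<^sub>M distr M B b"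
    using indep_var_distribution_eq[of A a B b] ind by simp
  also have "(\<integral>\<^sup>+p. (case p of (u, v) \<Rightarrow> F u v) \<partial>(distr M A a \<Otimes>\<^sub>M distr M B b))
      = (\<integral>\<^sup>+u. \<integral>\<^sup>+v. F u v \<partial>distr M B b \<partial>distr M A a)"
    by (subst B.nn_integral_fst[symmetric]) auto
  also have "\<dots> = (\<integral>\<^sup>+\<omega>. \<integral>\<^sup>+v. F (a \<omega>) v \<partial>distr M B b \<partial>M)"
    by (subst nn_integral_distr) auto
  also have "\<dots> = (\<integral>\<^sup>+\<omega>. \<integral>\<^sup>+\<omega>'. F (a \<omega>) (b \<omega>') \<partial>M \<partial>M)"
    by (intro nn_integral_cong nn_integral_distr) (auto dest: indep_var_rv1[OF ind, THEN measurable_space])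
  finally show ?thesis .
qed

text \<open>Were the limit inferior positive, \<open>d\<close> would eventually exceed some
  \<open>e > 0\<close>, and the bounded weighted sums would dominate, up to a constant,
  \<open>e\<close> times the divergent sums of \<alpha>.\<close>

lemma liminf_zero_if_weighted_sums_bounded:
  fixes \<alpha> :: "nat \<Rightarrow> real" and d :: "nat \<Rightarrow> ennreal"
  assumes \<alpha>: "\<And>k. 1 \<le> k \<Longrightarrow> 0 \<le> \<alpha> k"
    and div: "filterlim (\<lambda>n. \<Sum>k=1..n. \<alpha> k) at_top sequentially"
    and bound: "\<And>n. (\<Sum>k=1..n. ennreal (\<alpha> k) * d k) \<le> ennreal C"
  shows "liminf d = 0"
proof (rule ccontr)
  assume "liminf d \<noteq> 0"
  then have "0 < liminf d"
    by (simp add: zero_less_iff_neq_zero)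
  then obtain e' where e': "0 < e'" "e' < liminf d"
    using dense by blast
  then obtain e where e: "e' = ennreal e" "0 < e"
    by (cases e') auto
  have "eventually (\<lambda>n. e' < d n) sequentially"
    using e'(2) by (rule less_LiminfD)
  then obtain K where K: "\<And>n. K \<le> n \<Longrightarrow> e' < d n"
    by (auto simp: eventually_sequentially)
  \<comment> \<open>\<open>B\<close> pays for the indices up to \<open>K\<close>, where
    \<open>d\<close> has no lower bound.\<close>
  define B where "B = (\<Sum>k=1..K. e * \<alpha> k)"
  have B: "0 \<le> B"
    unfolding B_def using \<alpha> e by (intro sum_nonneg) auto
  \<comment> \<open>\<open>ennreal C\<close> is 0 for negative \<open>C\<close>, whence
    \<open>max C 0\<close> on returning to the reals.\<close>
  have le: "(\<Sum>k=1..n. \<alpha> k) \<le> (max C 0 + B) / e" if n: "K \<le> n" for n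
  proof -
    have "ennreal (\<Sum>k=1..n. e * \<alpha> k) = (\<Sum>k=1..n. ennreal (e * \<alpha> k))"
      using \<alpha> e by (intro sum_ennreal[symmetric]) auto
    also have "\<dots> \<le> (\<Sum>k=1..n. ennreal (\<alpha> k) * d k + (if k \<le> K then ennreal (e * \<alpha> k) else 0))"
    proof (rule sum_mono)
      fix k assume k: "k \<in> {1..n}"
      show "ennreal (e * \<alpha> k)
        \<le> ennreal (\<alpha> k) * d k + (if k \<le> K then ennreal (e * \<alpha> k) else 0)"
      proof (cases "k \<le> K")
        case False
        then have "ennreal (\<alpha> k) * ennreal e \<le> ennreal (\<alpha> k) * d k"
          using K[of k] e by (intro mult_left_mono) auto
        then show ?thesis
          using False \<alpha> e k by (simp add: ennreal_mult' mult.commute)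
      qed simp
    qed
    also have "\<dots> = (\<Sum>k=1..n. ennreal (\<alpha> k) * d k) + (\<Sum>k\<in>{k\<in>{1..n}. k \<le> K}. ennreal (e * \<alpha> k))"
      unfolding sum.distrib by (subst sum.inter_filter) simp_all
    also have "{k\<in>{1..n}. k \<le> K} = {1..K}"
      using n by auto
    also have "(\<Sum>k\<in>{1..K}. ennreal (e * \<alpha> k)) = ennreal B"
      unfolding B_def using \<alpha> e by (intro sum_ennreal) auto
    also have "(\<Sum>k=1..n. ennreal (\<alpha> k) * d k) + ennreal B \<le> ennreal (max C 0) + ennreal B"
      using bound[of n] by (intro add_right_mono, elim order_trans) (simp add: ennreal_leI)
    also have "\<dots> = ennreal (max C 0 + B)"
      using B by simp
    finally have "(\<Sum>k=1..n. e * \<alpha> k) \<le> max C 0 + B"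
      using B by (subst (asm) ennreal_le_iff) auto
    then show ?thesis
      using e by (simp add: sum_distrib_left[symmetric] field_simps)
  qed
  have "eventually (\<lambda>n. (max C 0 + B) / e < (\<Sum>k=1..n. \<alpha> k)) sequentially"
    using div by (simp add: filterlim_at_top_dense)
  moreover have "eventually (\<lambda>n. K \<le> n) sequentially"
    by (rule eventually_ge_at_top)
  ultimately have "eventually (\<lambda>n. False) sequentially"
    by eventually_elim (use le in fastforce)
  then show False
    by simp
qed

section \<open>Sample batches and the MLMC gradient estimator\<close>

lemma (in prob_space) indep_vars_reindex:
  assumes ind: "indep_vars M' X (h ` I)" and inj: "inj_on h I"
  shows "indep_vars (\<lambda>i. M' (h i)) (\<lambda>i. X (h i)) I"
  unfolding indep_vars_def2
proof (intro conjI ballI indep_setsI)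
  let ?F = "\<lambda>i. {X i -` A \<inter> space M | A. A \<in> sets (M' i)}"
  have F: "indep_sets ?F (h ` I)"
    using ind by (simp add: indep_vars_def2)
  show "random_variable (M' (h i)) (X (h i))" if "i \<in> I" for i
    using ind that by (simp add: indep_vars_def2)
  show "?F (h i) \<subseteq> events" if "i \<in> I" for i
    using F that by (auto simp: indep_sets_def)
  fix A J assume J: "J \<noteq> {}" "J \<subseteq> I" "finite J" and A: "\<forall>j\<in>J. A j \<in> ?F (h j)"
  have injJ: "inj_on h J"
    using inj J(2) by (rule inj_on_subset)
  define A' where "A' = (\<lambda>i. A (inv_into J h i))"
  have A': "A' (h j) = A j" if "j \<in> J" for j
    using that injJ by (simp add: A'_def)
  have "prob (\<Inter>i\<in>h ` J. A' i) = (\<Prod>i\<in>h ` J. prob (A' i))"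
  proof (rule indep_setsD[OF F])
    show "\<forall>i\<in>h ` J. A' i \<in> ?F i"
      using A A' by auto
  qed (use J in auto)
  then show "prob (\<Inter>j\<in>J. A j) = (\<Prod>j\<in>J. prob (A j))"
    using A' injJ by (simp add: prod.reindex)
qed

text \<open>A batch is an injective reindexing of part of the independent family, so its law is the
  product of its marginals, each of which is the law of \<xi>. Hypotheses stated under
  \<open>iid_law\<close> thereby transfer to the samples actually drawn.\<close>

lemma (in prob_space) distr_batch:
  assumes indep: "indep_vars (\<lambda>_. S) (\<lambda>(k, i). X k i) ({1..} \<times> {..<m})"
    and ident: "\<And>k i. 1 \<le> k \<Longrightarrow> i < m \<Longrightarrow> distr M S (X k i) = distr M S \<xi>"
    and k: "1 \<le> k" and n: "1 \<le> n" "s + n \<le> m"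
  shows "distr M (\<Pi>\<^sub>M i\<in>{..<n}. S) (batch X k s n) = iid_law M S \<xi> n"
proof -
  have rv: "random_variable S (X k i)" if "i < m" for i
    using indep that k unfolding indep_vars_def by auto
  have "indep_vars (\<lambda>_. S) (\<lambda>i. X k (s + i)) {..<n}"
  proof -
    have "indep_vars (\<lambda>_. S) (\<lambda>(k, i). X k i) ((\<lambda>i. (k, s + i)) ` {..<n})"
      using indep by (rule indep_vars_subset) (use n k in auto)
    from indep_vars_reindex[OF this] show ?thesis
      by (simp add: inj_on_def)
  qed
  then have "distr M (\<Pi>\<^sub>M i\<in>{..<n}. S) (\<lambda>\<omega>. \<lambda>i\<in>{..<n}. X k (s + i) \<omega>)
      = (\<Pi>\<^sub>M i\<in>{..<n}. distr M S (X k (s + i)))"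
    using n rv by (subst (asm) indep_vars_iff_distr_eq_PiM') (auto simp: lessThan_empty_iff)
  also have "\<dots> = iid_law M S \<xi> n"
    unfolding iid_law_def using n k ident by (intro PiM_cong) auto
  finally show ?thesis
    by (simp add: batch_def[abs_def])
qed
text \<open>Each of the three terms is unbiased under the law of its batch, and the two low-fidelity
  gradients cancel by linearity.\<close>

lemma (in prob_space) has_bochner_integral_mlmc_grad:
  assumes indep: "indep_vars (\<lambda>_. S) (\<lambda>(k, i). X k i) ({1..} \<times> {..<N + M'})"
    and ident: "\<And>k i. 1 \<le> k \<Longrightarrow> i < N + M' \<Longrightarrow> distr M S (X k i) = distr M S \<xi>"
    and EH: "unbiased_grad_estimator M S \<xi> EH RH" and EL: "unbiased_grad_estimator M S \<xi> EL RL"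
    and k: "1 \<le> k" and sizes: "1 \<le> N" "1 \<le> M'"
  shows "has_bochner_integral M (mlmc_grad EH EL N M' X k y) (gradient RH y)"
proof -
  have batch: "has_bochner_integral M (\<lambda>\<omega>. grad_est E n y (batch X k s n \<omega>)) (gradient F y)"
    if E: "unbiased_grad_estimator M S \<xi> E F" and n: "1 \<le> n" "s + n \<le> N + M'" for E F n s
  proof -
    have law: "distr M (\<Pi>\<^sub>M i\<in>{..<n}. S) (batch X k s n) = iid_law M S \<xi> n"
      by (rule distr_batch[OF indep ident k n]) auto
    have "(\<lambda>(y, z). grad_est E n y z) \<in> borel_measurable (borel \<Otimes>\<^sub>M (\<Pi>\<^sub>M i\<in>{..<n}. S))"
      using E n(1) by (simp add: unbiased_grad_estimator_def)
    from measurable_compose[OF measurable_Pair1' this, of y]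
    have m: "grad_est E n y \<in> borel_measurable (\<Pi>\<^sub>M i\<in>{..<n}. S)"
      by simp
    have X: "random_variable S (X k (s + i))" if "i < n" for i
      using indep that k n unfolding indep_vars_def by auto
    have b: "batch X k s n \<in> M \<rightarrow>\<^sub>M (\<Pi>\<^sub>M i\<in>{..<n}. S)"
      unfolding batch_def[abs_def] using X by (intro measurable_restrict) auto
    have "has_bochner_integral (iid_law M S \<xi> n) (grad_est E n y) (gradient F y)"
      using E n(1) by (simp add: unbiased_grad_estimator_def)
    then show ?thesis
      unfolding law[symmetric]
      using m b by (simp add: has_bochner_integral_iff integrable_distr_eq integral_distr)
  qed
  have "has_bochner_integral M (mlmc_grad EH EL N M' X k y)
      (gradient RH y - (gradient RL y - gradient RL y))"
    unfolding mlmc_grad_def[abs_def]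
    using sizes by (intro has_bochner_integral_diff batch EH EL) auto
  then show ?thesis
    by simp
qed

text \<open>Separates the point from the randomness: \<open>\<Gamma>\<close> is jointly measurable
  in the point and the sample vector of iteration \<open>k\<close>, as needed for inserting a random
  iterate and applying Tonelli.\<close>

lemma mlmc_grad_factorization:
  fixes EH EL :: "('a::euclidean_space, 's) estimator"
  assumes EH: "unbiased_grad_estimator P S \<xi> EH RH" and EL: "unbiased_grad_estimator P S \<xi> EL RL"
    and sizes: "1 \<le> N" "1 \<le> M"
  obtains \<Gamma> where
    "(\<lambda>(y, z). \<Gamma> y z) \<in> borel_measurable (borel \<Otimes>\<^sub>M (\<Pi>\<^sub>M j\<in>{k} \<times> {..<N + M}. S))"
    "\<And>y \<omega>. mlmc_grad EH EL N M X k y \<omega> = \<Gamma> y (restrict (\<lambda>(k, i). X k i \<omega>) ({k} \<times> {..<N + M}))"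
proof
  let ?Z = "\<Pi>\<^sub>M j\<in>{k} \<times> {..<N + M}. S"
  \<comment> \<open>The counterpart of \<open>batch\<close>, reading from a sample vector instead of
    from an outcome.\<close>
  define b where "b s n z = (\<lambda>i\<in>{..<n}. z (k, s + i))" for s n and z :: "nat \<times> nat \<Rightarrow> 's"
  define \<Gamma> where "\<Gamma> y z = grad_est EH N y (b 0 N z)
    - (grad_est EL N y (b 0 N z) - grad_est EL M y (b N M z))" for y z
  have m: "(\<lambda>(y, z). grad_est E n y (b s n z)) \<in> borel_measurable (borel \<Otimes>\<^sub>M ?Z)"
    if E: "unbiased_grad_estimator P S \<xi> E F" and n: "1 \<le> n" "s + n \<le> N + M" for E F n s
  proof -
    have [measurable]: "b s n \<in> ?Z \<rightarrow>\<^sub>M (\<Pi>\<^sub>M i\<in>{..<n}. S)"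
      unfolding b_def[abs_def] using n by (intro measurable_restrict measurable_component_singleton) auto
    have [measurable]: "(\<lambda>(y, z). grad_est E n y z) \<in> borel_measurable (borel \<Otimes>\<^sub>M (\<Pi>\<^sub>M i\<in>{..<n}. S))"
      using E n(1) by (simp add: unbiased_grad_estimator_def)
    show ?thesis
      by measurable
  qed
  show "(\<lambda>(y, z). \<Gamma> y z) \<in> borel_measurable (borel \<Otimes>\<^sub>M ?Z)"
    using m[OF EH, of N 0] m[OF EL, of N 0] m[OF EL, of M N] sizes
    unfolding \<Gamma>_def split_beta' by (intro borel_measurable_diff) auto
  show "mlmc_grad EH EL N M X k y \<omega> = \<Gamma> y (restrict (\<lambda>(k, i). X k i \<omega>) ({k} \<times> {..<N + M}))"
    for y \<omega>
  proof -
    have "b s n (restrict (\<lambda>(k, i). X k i \<omega>) ({k} \<times> {..<N + M})) = batch X k s n \<omega>"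
      if "s + n \<le> N + M" for s n
      using that by (auto simp: b_def batch_def fun_eq_iff)
    then show ?thesis
      by (simp add: \<Gamma>_def mlmc_grad_def)
  qed
qed

section \<open>Convergence of the stochastic gradient iteration\<close>

theorem theorem5p11:
  fixes P :: "'w measure" and S :: "'s measure" and \<xi> :: "'w \<Rightarrow> 's"
    and J_H J_L :: "real ^ 'd \<Rightarrow> 's \<Rightarrow> real"
    and R :: "('w \<Rightarrow> real) \<Rightarrow> real"
    and R_H R_L :: "real ^ 'd \<Rightarrow> real"
    and Rhat_H Rhat_L :: "(real ^ 'd, 's) estimator"
    and X :: "nat \<Rightarrow> nat \<Rightarrow> 'w \<Rightarrow> 's"
    and G :: "nat \<Rightarrow> real ^ 'd \<Rightarrow> 'w \<Rightarrow> real ^ 'd"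
    and N M :: nat
    and L_H W_ML W_VML :: real
    and \<alpha> :: "nat \<Rightarrow> real"
    and x1 :: "real ^ 'd" and x :: "nat \<Rightarrow> 'w \<Rightarrow> real ^ 'd"
  assumes "prob_space P" and "\<xi> \<in> P \<rightarrow>\<^sub>M S"
    and "\<And>y. J_H y \<in> borel_measurable S" and "\<And>y. J_L y \<in> borel_measurable S"
    and R_H: "R_H = risk R J_H \<xi>" and R_L: "R_L = risk R J_L \<xi>"
    and diff_H: "\<And>y. \<exists>D. GDERIV R_H y :> D" and diff_L: "\<And>y. \<exists>D. GDERIV R_L y :> D"
    and unbiased_H: "unbiased_grad_estimator P S \<xi> Rhat_H R_H"
    and unbiased_L: "unbiased_grad_estimator P S \<xi> Rhat_L R_L"
    and sizes: "1 \<le> N" "N < M"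
    and indep: "prob_space.indep_vars P (\<lambda>_. S) (\<lambda>(k, i). X k i) ({1..} \<times> {..<N + M})"
    and ident: "\<And>k i. 1 \<le> k \<Longrightarrow> i < N + M \<Longrightarrow> distr P S (X k i) = distr P S \<xi>"
    and G: "G = mlmc_grad Rhat_H Rhat_L N M X"
    and lipschitz: "L_H-lipschitz_on UNIV (gradient R_H)"
    and bounded_below: "bdd_below (range R_H)"
    and W_nonneg: "0 \<le> W_ML" "0 \<le> W_VML"
    and second_moment: "\<And>k y. 1 \<le> k \<Longrightarrow> integrable P (\<lambda>\<omega>. (norm (G k y \<omega>))\<^sup>2)"
    and variance: "\<And>k y. 1 \<le> k \<Longrightarrow>
      (\<integral>\<omega>. (norm (G k y \<omega>))\<^sup>2 \<partial>P) - (norm (\<integral>\<omega>. G k y \<omega> \<partial>P))\<^sup>2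
        \<le> W_ML + W_VML * (norm (gradient R_H y))\<^sup>2"
    and start: "\<And>\<omega>. x 1 \<omega> = x1"
    and step: "\<And>k \<omega>. 1 \<le> k \<Longrightarrow> x (k + 1) \<omega> = x k \<omega> - \<alpha> k *\<^sub>R G k (x k \<omega>) \<omega>"
    and rate_nonneg: "\<And>k. 1 \<le> k \<Longrightarrow> 0 \<le> \<alpha> k"
    and rate_sum: "filterlim (\<lambda>n. \<Sum>k=1..n. \<alpha> k) at_top sequentially"
    and rate_sum_sq: "summable (\<lambda>k. (\<alpha> (Suc k))\<^sup>2)"
    and rate_bound: "\<And>k. 1 \<le> k \<Longrightarrow> 0 < L_H \<Longrightarrow> \<alpha> k \<le> 1 / (L_H * (W_VML + 1))"
  shows "liminf (\<lambda>k. \<integral>\<^sup>+\<omega>. ennreal ((norm (gradient R_H (x k \<omega>)))\<^sup>2) \<partial>P) = 0"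
proof -
  interpret P: prob_space P
    by fact
  have M1: "1 \<le> M"
    using sizes by simp
  define F where "F = gradient R_H"
  define c where "c = Inf (range R_H)"
  define f where "f y = R_H y - c" for y
  have f0: "0 \<le> f y" for y
    unfolding f_def c_def using bounded_below by (simp add: cInf_lower)
  have der: "GDERIV f y :> F y" for y
  proof -
    have "GDERIV R_H y :> F y"
      using diff_H gradient_eq F_def by metis
    from GDERIV_diff[OF this GDERIV_const] show ?thesis
      by (simp add: f_def[abs_def])
  qed
  have "continuous_on UNIV F"
    using lipschitz unfolding F_def by (rule lipschitz_on_continuous_on)
  then have [measurable]: "F \<in> borel_measurable borel"
    by (rule borel_measurable_continuous_onI)
  have "continuous_on UNIV f"
    using der[unfolded gderiv_def]
    by (blast intro: continuous_at_imp_continuous_on has_derivative_continuous)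
  then have [measurable]: "f \<in> borel_measurable borel"
    by (rule borel_measurable_continuous_onI)

  \<comment> \<open>Step sizes and the Lipschitz constant\<close>
  define Q where "Q = (\<Sum>k. (\<alpha> (Suc k))\<^sup>2)"
  have sq_le: "(\<Sum>k=1..n. (\<alpha> k)\<^sup>2) \<le> Q" for n
    using sum_le_suminf[OF rate_sum_sq, of "{..<n}"]
    by (simp add: Q_def sum.atLeast1_atMost_eq)
  \<comment> \<open>For \<open>L_H = 0\<close> the hypothesis on the rates is void; a small positive Lipschitz constant serves instead.\<close>
  obtain L where L: "L-lipschitz_on UNIV F" "\<And>k. 1 \<le> k \<Longrightarrow> \<alpha> k * (L * (W_VML + 1)) \<le> 1"
  proof (cases "L_H = 0")
    case True
    \<comment> \<open>Chosen so that \<open>L * (W_VML + 1) = 1 / (Q + 1)\<close>, where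
      \<open>Q + 1\<close> bounds every rate.\<close>
    define L where "L = 1 / ((Q + 1) * (W_VML + 1))"
    have Q0: "0 \<le> Q"
      using sq_le[of 0] by simp
    have "L-lipschitz_on UNIV F"
      unfolding F_def using lipschitz
      by (rule lipschitz_on_le) (use True Q0 W_nonneg in \<open>simp add: L_def\<close>)
    moreover have "\<alpha> k * (L * (W_VML + 1)) \<le> 1" if "1 \<le> k" for k
    proof -
      have "(\<alpha> k)\<^sup>2 \<le> (\<Sum>k=1..k. (\<alpha> k)\<^sup>2)"
        using that by (intro member_le_sum) auto
      also note sq_le[of k]
      \<comment> \<open>Uses \<open>t \<le> t\<^sup>2 + 1 / 4\<close>, that is, the nonnegativity of
        \<open>(t - 1 / 2)\<^sup>2\<close>.\<close>
      finally have "\<alpha> k \<le> Q + 1"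
        using zero_le_power2[of "\<alpha> k - 1 / 2"] by (simp add: power2_diff power_divide)
      moreover have "W_VML + 1 \<noteq> 0"
        using W_nonneg by linarith
      then have "L * (W_VML + 1) = 1 / (Q + 1)"
        by (simp add: L_def)
      ultimately show ?thesis
        using Q0 by simp
    qed
    ultimately show ?thesis
      by (rule that)
  next
    case False
    then have L0: "0 < L_H"
      using lipschitz_on_nonneg[OF lipschitz] by simp
    have "0 < L_H * (W_VML + 1)"
      using L0 W_nonneg by (intro mult_pos_pos) auto
    then have "\<alpha> k * (L_H * (W_VML + 1)) \<le> 1" if "1 \<le> k" for k
      using rate_bound[OF that L0] by (simp only: pos_le_divide_eq)
    then show ?thesis
      by (rule that[OF lipschitz[folded F_def]])
  qed
  have L0: "0 \<le> L"
    using L(1) by (rule lipschitz_on_nonneg)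

  \<comment> \<open>Iterates as functions of past samples\<close>
  define Z where "Z A \<omega> = restrict (\<lambda>(k, i). X k i \<omega>) (A \<times> {..<N + M})" for A \<omega>
  define \<Z> where "\<Z> A = (\<Pi>\<^sub>M j\<in>A \<times> {..<N + M}. S)" for A :: "nat set"
  \<comment> \<open>Past and current samples occupy disjoint blocks of one independent
    family.\<close>
  have indepZ: "P.indep_var (\<Z> {1..<k}) (Z {1..<k}) (\<Z> {k}) (Z {k})" if "1 \<le> k" for k
  proof -
    have "({1..<k} \<times> {..<N + M}) \<inter> ({k} \<times> {..<N + M}) = {}"
      "{1..<k} \<times> {..<N + M} \<subseteq> {1..} \<times> {..<N + M}" "{k} \<times> {..<N + M} \<subseteq> {1..} \<times> {..<N + M}"
      using that by auto
    from P.indep_var_restrict[OF indep this] show ?thesis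
      unfolding Z_def[abs_def] \<Z>_def by (simp add: case_prod_beta')
  qed
  have "\<forall>k. \<exists>\<Gamma>. (\<lambda>(y, z). \<Gamma> y z) \<in> borel_measurable (borel \<Otimes>\<^sub>M \<Z> {k}) \<and>
      (\<forall>y \<omega>. G k y \<omega> = \<Gamma> y (Z {k} \<omega>))"
    unfolding G Z_def \<Z>_def
  proof
    fix k
    show "\<exists>\<Gamma>. (\<lambda>(y, z). \<Gamma> y z) \<in> borel_measurable (borel \<Otimes>\<^sub>M (\<Pi>\<^sub>M j\<in>{k} \<times> {..<N + M}. S)) \<and>
        (\<forall>y \<omega>. mlmc_grad Rhat_H Rhat_L N M X k y \<omega>
          = \<Gamma> y (restrict (\<lambda>(k, i). X k i \<omega>) ({k} \<times> {..<N + M})))"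
      by (rule mlmc_grad_factorization[OF unbiased_H unbiased_L sizes(1) M1, of k X]) blast
  qed
  then obtain \<Gamma> where \<Gamma>_m [measurable]: "\<And>k. (\<lambda>(y, z). \<Gamma> k y z) \<in> borel_measurable (borel \<Otimes>\<^sub>M \<Z> {k})"
    and \<Gamma>: "\<And>k y \<omega>. G k y \<omega> = \<Gamma> k y (Z {k} \<omega>)"
    by metis

  \<comment> \<open>Saves the recursion under another name, since the induction case below shadows
    \<open>step\<close>.\<close>
  note recursion = step
  have iterate: "\<exists>h. h \<in> borel_measurable (\<Z> {1..<k}) \<and> (\<forall>\<omega>. x k \<omega> = h (Z {1..<k} \<omega>))"
    if "1 \<le> k" for k
    using that
  proof (induction k rule: dec_induct)
    case base
    show ?case
      using start by (intro exI[of _ "\<lambda>_. x1"]) auto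
  next
    case (step k)
    then obtain h where h [measurable]: "h \<in> borel_measurable (\<Z> {1..<k})"
      and xk: "\<And>\<omega>. x k \<omega> = h (Z {1..<k} \<omega>)"
      by blast
    \<comment> \<open>Recovers both the earlier samples, which determine \<open>x k\<close>, and the
      current ones, which enter through \<open>\<Gamma> k\<close>, from the vector of all samples up
      to iteration \<open>k\<close>.\<close>
    define r where "r A z = restrict z (A \<times> {..<N + M})" for A and z :: "nat \<times> nat \<Rightarrow> 's"
    have r_m: "r A \<in> \<Z> {1..<Suc k} \<rightarrow>\<^sub>M \<Z> A" if "A \<subseteq> {1..<Suc k}" for A
      unfolding r_def[abs_def] \<Z>_def using that by (intro measurable_restrict_subset) auto
    have [measurable]: "r {1..<k} \<in> \<Z> {1..<Suc k} \<rightarrow>\<^sub>M \<Z> {1..<k}"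
      "r {k} \<in> \<Z> {1..<Suc k} \<rightarrow>\<^sub>M \<Z> {k}"
      using step.hyps r_m[of "{1..<k}"] r_m[of "{k}"] by auto
    define h' where "h' z = h (r {1..<k} z) - \<alpha> k *\<^sub>R \<Gamma> k (h (r {1..<k} z)) (r {k} z)" for z
    have "h' \<in> borel_measurable (\<Z> {1..<Suc k})"
      unfolding h'_def[abs_def] by measurable
    moreover have "x (Suc k) \<omega> = h' (Z {1..<Suc k} \<omega>)" for \<omega>
    proof -
      have "r A (Z {1..<Suc k} \<omega>) = Z A \<omega>" if "A \<subseteq> {1..<Suc k}" for A
        using that by (auto simp: r_def Z_def fun_eq_iff)
      from this[of "{1..<k}"] this[of "{k}"] show ?thesis
        using recursion[of k \<omega>] step.hyps by (simp add: h'_def xk \<Gamma>)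
    qed
    ultimately show ?case
      by blast
  qed

  \<comment> \<open>Descent along the random iterates\<close>
  define e where "e k = (\<integral>\<^sup>+\<omega>. ennreal (f (x k \<omega>)) \<partial>P)" for k
  define d where "d k = (\<integral>\<^sup>+\<omega>. ennreal ((norm (F (x k \<omega>)))\<^sup>2) \<partial>P)" for k
  have descent: "e (Suc k) + ennreal (\<alpha> k / 2) * d k \<le> e k + ennreal (L / 2 * W_ML * (\<alpha> k)\<^sup>2)"
    if k: "1 \<le> k" for k
  proof -
    obtain h where h [measurable]: "h \<in> borel_measurable (\<Z> {1..<k})"
      and xk: "\<And>\<omega>. x k \<omega> = h (Z {1..<k} \<omega>)"
      using iterate[OF k] by blast
    have [measurable]: "Z {1..<k} \<in> P \<rightarrow>\<^sub>M \<Z> {1..<k}" "Z {k} \<in> P \<rightarrow>\<^sub>M \<Z> {k}"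
      using P.indep_var_rv1[OF indepZ[OF k]] P.indep_var_rv2[OF indepZ[OF k]] by auto
    have [measurable]: "x k \<in> borel_measurable P"
      unfolding xk[abs_def] by measurable
    have one_step: "(\<integral>\<^sup>+\<omega>. ennreal (f (y - \<alpha> k *\<^sub>R G k y \<omega>)) \<partial>P)
          + ennreal (\<alpha> k / 2 * (norm (F y))\<^sup>2)
        \<le> ennreal (f y) + ennreal (L / 2 * W_ML * (\<alpha> k)\<^sup>2)" for y
    proof (rule P.expected_gradient_step_decrease[OF f0 der L(1)])
      show mean: "has_bochner_integral P (G k y) (F y)"
        unfolding G F_def
        by (rule P.has_bochner_integral_mlmc_grad[OF indep ident unbiased_H unbiased_L k sizes(1) M1])
      show "(\<integral>\<omega>. (norm (G k y \<omega>))\<^sup>2 \<partial>P) - (norm (F y))\<^sup>2 \<le> W_ML + W_VML * (norm (F y))\<^sup>2"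
        using variance[OF k, of y] mean by (simp add: has_bochner_integral_iff F_def)
    qed (use k second_moment rate_nonneg L(2) W_nonneg in auto)
    \<comment> \<open>Written through \<open>h\<close> and \<open>\<Gamma> k\<close>, the integrand
      depends on two independent blocks only. Decoupling them leaves an inner integral at a frozen
      iterate, to which \<open>one_step\<close> applies.\<close>
    have "e (Suc k) = (\<integral>\<^sup>+\<omega>. ennreal (f (h (Z {1..<k} \<omega>)
        - \<alpha> k *\<^sub>R \<Gamma> k (h (Z {1..<k} \<omega>)) (Z {k} \<omega>))) \<partial>P)"
      using step[OF k] by (simp add: e_def xk \<Gamma>)
    also have "\<dots> = (\<integral>\<^sup>+\<omega>. \<integral>\<^sup>+\<omega>'. ennreal (f (h (Z {1..<k} \<omega>)
        - \<alpha> k *\<^sub>R \<Gamma> k (h (Z {1..<k} \<omega>)) (Z {k} \<omega>'))) \<partial>P \<partial>P)"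
      by (rule P.nn_integral_indep_var[OF indepZ[OF k]]) measurable
    also have "\<dots> = (\<integral>\<^sup>+\<omega>. \<integral>\<^sup>+\<omega>'. ennreal (f (x k \<omega> - \<alpha> k *\<^sub>R G k (x k \<omega>) \<omega>')) \<partial>P \<partial>P)"
      by (simp add: xk \<Gamma>)
    finally have e_Suc: "e (Suc k) = \<dots>" .
    have d_scaled: "ennreal (\<alpha> k / 2) * d k = (\<integral>\<^sup>+\<omega>. ennreal (\<alpha> k / 2 * (norm (F (x k \<omega>)))\<^sup>2) \<partial>P)"
    proof -
      have "ennreal (\<alpha> k / 2 * (norm (F (x k \<omega>)))\<^sup>2)
          = ennreal (\<alpha> k / 2) * ennreal ((norm (F (x k \<omega>)))\<^sup>2)" for \<omega>
        using rate_nonneg[OF k] by (intro ennreal_mult) auto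
      then show ?thesis
        unfolding d_def by (simp only:) (rule nn_integral_cmult[symmetric], measurable)
    qed
    have "e (Suc k) + ennreal (\<alpha> k / 2) * d k
        = (\<integral>\<^sup>+\<omega>. (\<integral>\<^sup>+\<omega>'. ennreal (f (x k \<omega> - \<alpha> k *\<^sub>R G k (x k \<omega>) \<omega>')) \<partial>P)
            + ennreal (\<alpha> k / 2 * (norm (F (x k \<omega>)))\<^sup>2) \<partial>P)"
      unfolding e_Suc d_scaled \<Gamma> by (rule nn_integral_add[symmetric]) measurable
    also have "\<dots> \<le> (\<integral>\<^sup>+\<omega>. ennreal (f (x k \<omega>)) + ennreal (L / 2 * W_ML * (\<alpha> k)\<^sup>2) \<partial>P)"
      by (intro nn_integral_mono one_step)
    also have "\<dots> = e k + ennreal (L / 2 * W_ML * (\<alpha> k)\<^sup>2)"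
      unfolding e_def by (subst nn_integral_add) (auto simp: P.emeasure_space_1)
    finally show ?thesis .
  qed

  \<comment> \<open>Summation over the iterations\<close>
  \<comment> \<open>The additive form avoids subtraction of extended reals, as \<open>e\<close> and
    \<open>d\<close> are not known to be finite at this point.\<close>
  have telescope: "e (Suc n) + (\<Sum>k=1..n. ennreal (\<alpha> k / 2) * d k)
      \<le> e 1 + (\<Sum>k=1..n. ennreal (L / 2 * W_ML * (\<alpha> k)\<^sup>2))" for n
  proof (induction n)
    case (Suc n)
    let ?s = "\<Sum>k=1..n. ennreal (\<alpha> k / 2) * d k"
    have "e (Suc (Suc n)) + (\<Sum>k=1..Suc n. ennreal (\<alpha> k / 2) * d k)
        = (e (Suc (Suc n)) + ennreal (\<alpha> (Suc n) / 2) * d (Suc n)) + ?s"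
      by (simp add: ac_simps)
    also have "\<dots> \<le> (e (Suc n) + ennreal (L / 2 * W_ML * (\<alpha> (Suc n))\<^sup>2)) + ?s"
      by (intro add_right_mono descent) simp
    also have "\<dots> = (e (Suc n) + ?s) + ennreal (L / 2 * W_ML * (\<alpha> (Suc n))\<^sup>2)"
      by (simp add: ac_simps)
    also have "\<dots> \<le> (e 1 + (\<Sum>k=1..n. ennreal (L / 2 * W_ML * (\<alpha> k)\<^sup>2)))
        + ennreal (L / 2 * W_ML * (\<alpha> (Suc n))\<^sup>2)"
      by (intro add_right_mono Suc.IH)
    finally show ?case
      by (simp add: ac_simps)
  qed simp
  \<comment> \<open>Dropping \<open>e (Suc n)\<close> leaves a bound independent of
    \<open>n\<close>: the start is deterministic, so \<open>e 1\<close> is finite, and the noise is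
    controlled by the sum \<open>Q\<close> of squared rates.\<close>
  have "(\<Sum>k=1..n. ennreal (\<alpha> k / 2) * d k) \<le> ennreal (f x1 + L / 2 * W_ML * Q)" for n
  proof -
    have "(\<Sum>k=1..n. ennreal (\<alpha> k / 2) * d k) \<le> e (Suc n) + (\<Sum>k=1..n. ennreal (\<alpha> k / 2) * d k)"
      by (rule add_increasing) auto
    also note telescope
    also have "e 1 = ennreal (f x1)"
      using start by (simp add: e_def P.emeasure_space_1)
    also have "(\<Sum>k=1..n. ennreal (L / 2 * W_ML * (\<alpha> k)\<^sup>2)) = ennreal (L / 2 * W_ML * (\<Sum>k=1..n. (\<alpha> k)\<^sup>2))"
      using L0 W_nonneg by (subst sum_ennreal) (auto simp: sum_distrib_left)
    also have "\<dots> \<le> ennreal (L / 2 * W_ML * Q)"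
      using sq_le L0 W_nonneg by (intro ennreal_leI mult_left_mono) auto
    also have "ennreal (f x1) + ennreal (L / 2 * W_ML * Q) = ennreal (f x1 + L / 2 * W_ML * Q)"
      using f0 L0 W_nonneg sq_le[of 0] by (intro ennreal_plus[symmetric]) auto
    finally show ?thesis
      by (auto simp: add_left_mono)
  qed
  \<comment> \<open>The weights in the liminf criterion are the halved rates, whose sums still
    diverge.\<close>
  moreover have "filterlim (\<lambda>n. \<Sum>k=1..n. \<alpha> k / 2) at_top sequentially"
    using filterlim_tendsto_pos_mult_at_top[OF tendsto_const _ rate_sum, of "1 / 2"]
    by (simp add: sum_divide_distrib)
  ultimately have "liminf d = 0"
    using rate_nonneg by (intro liminf_zero_if_weighted_sums_bounded[of "\<lambda>k. \<alpha> k / 2"]) auto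
  then show ?thesis
    by (simp add: d_def[abs_def] F_def)
qed

end
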